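(* Let $r\ge 2$ be an integer and let $\mathcal{H}$ be a connected $r$-uniform hypergraph on $n$ vertices with $e(\mathcal{H})\ge n$. Then for every vertex $v\in V(\mathcal{H})$, either there exists a Berge path of length $r+1$ starting from $v$, or there exists a Berge cycle of length $r+1$ having $v$ as one of its vertices.
   Context: A hypergraph $\mathcal{H}$ consists of a finite vertex set $V(\mathcal{H})$ and a set $E(\mathcal{H})$ of distinct subsets of $V(\mathcal{H})$ (hyperedges; no repeated hyperedges); $n=|V(\mathcal{H})|$ and $e(\mathcal{H})=|E(\mathcal{H})|$. It is $r$-uniform if every hyperedge has exactly $r$ vertices. It is connected if for any two vertices $x,y$ there is a sequence of vertices $x=x_0,x_1,\dots,x_m=y$ such that each consecutive pair $x_{j-1},x_j$ lies in a common hyperedge. A Berge path of length $k$ is a collection of $k$ distinct hyperedges $e_1,\dots,e_k$ and $k+1$ distinct vertices $v_1,\dots,v_{k+1}$ such that $v_i,v_{i+1}\in e_i$ for each $1\le i\le k$; it starts at $v_1$. A Berge cycle of length $k$ is a collection of $k$ distinct hyperedges $e_1,\dots,e_k$ and $k$ distinct vertices $v_1,\dots,v_k$ such that $v_i,v_{i+1}\in e_i$ for $1\le i\le k-1$ and $v_k,v_1\in e_k$; the $v_i$ are its vertices. *)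

theory Defs
  imports Main
begin

definition hypergraph :: "'a set \<Rightarrow> 'a set set \<Rightarrow> bool" where
  "hypergraph V E \<longleftrightarrow> finite V \<and> E \<subseteq> Pow V"

definition uniform :: "nat \<Rightarrow> 'a set set \<Rightarrow> bool" where
  "uniform r E \<longleftrightarrow> (\<forall>e\<in>E. card e = r)"

definition connected_hypergraph :: "'a set \<Rightarrow> 'a set set \<Rightarrow> bool" where
  "connected_hypergraph V E \<longleftrightarrow>
     (\<forall>x\<in>V. \<forall>y\<in>V. \<exists>(m::nat) p. p 0 = x \<and> p m = y \<and> (\<forall>j\<le>m. p j \<in> V) \<and>
        (\<forall>j<m. \<exists>e\<in>E. p j \<in> e \<and> p (Suc j) \<in> e))"

text \<open>
  In the next two definitions the hyperedges $e_1,\dots,e_k$ and the vertices $v_1, v_2, \dots$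
  are given as lists, so that $e_i$ is \<open>es ! (i - 1)\<close> and $v_i$ is \<open>vs ! (i - 1)\<close>.
\<close>

definition berge_path :: "'a set \<Rightarrow> 'a set set \<Rightarrow> nat \<Rightarrow> 'a set list \<Rightarrow> 'a list \<Rightarrow> bool" where
  "berge_path V E k es vs \<longleftrightarrow>
     length es = k \<and> distinct es \<and> set es \<subseteq> E \<and>
     length vs = k + 1 \<and> distinct vs \<and> set vs \<subseteq> V \<and>
     (\<forall>i<k. vs ! i \<in> es ! i \<and> vs ! (i + 1) \<in> es ! i)"

definition berge_cycle :: "'a set \<Rightarrow> 'a set set \<Rightarrow> nat \<Rightarrow> 'a set list \<Rightarrow> 'a list \<Rightarrow> bool" where
  "berge_cycle V E k es vs \<longleftrightarrow>
     length es = k \<and> distinct es \<and> set es \<subseteq> E \<and>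
     length vs = k \<and> distinct vs \<and> set vs \<subseteq> V \<and>
     (\<forall>i<k. vs ! i \<in> es ! i \<and> vs ! ((i + 1) mod k) \<in> es ! i)"

end

theory Submission
  imports Defs
begin

text \<open>
  It suffices to find an alternating path $v = v_1, e_1, \dots, v_{r+1}, e_{r+1}$: either $e_{r+1}$
  extends it to a new vertex, or contains $v$ and closes a cycle, or equals
  $\{v_2,\dots,v_{r+1}\}$; in the last case, rotating the path makes $e_2$ its last hyperedge,
  which would then be the same set.
  If no such path exists, then $e(H) < n$. Indeed, if every alternating path from $v$ that ends in a
  hyperedge can be extended by a vertex, depth-first search assigns to each hyperedge its own child
  vertex, and the root $v$ is left over. Otherwise some hyperedge is exactly the vertex set of a
  path with $r$ vertices, which gives a Berge cycle of length $r$ through $v$. Rotating it shows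
  that its other vertices, together with all the neighbours of these, are attached to the rest of
  the hypergraph only at $v$, and that they are at least as many as the hyperedges meeting them, so
  that all of these can be deleted and induction applies.
\<close>

section \<open>Walks and paths\<close>

text \<open>The catch-all equation rejects lists of mismatched lengths, so a walk begins and ends in
  a vertex.\<close>

fun walk :: "'a list \<Rightarrow> 'a set list \<Rightarrow> bool" where
  "walk [x] [] \<longleftrightarrow> True"
| "walk (x # y # xs) (e # es) \<longleftrightarrow> x \<in> e \<and> y \<in> e \<and> walk (y # xs) es"
| "walk _ _ \<longleftrightarrow> False"

lemma walk_length: "walk xs es \<Longrightarrow> length xs = Suc (length es)"
  by (induction xs es rule: walk.induct) auto

lemma walk_append:
  assumes "length xs = Suc (length es)" "ys \<noteq> []"
  shows "walk (xs @ ys) (es @ e # fs) \<longleftrightarrow>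
           walk xs es \<and> last xs \<in> e \<and> hd ys \<in> e \<and> walk ys fs"
  using assms
proof (induction es arbitrary: xs)
  case Nil
  then obtain x where "xs = [x]" by (cases xs) auto
  with Nil show ?case by (cases ys) auto
next
  case (Cons a es)
  then obtain x y zs where xs: "xs = x # y # zs"
    by (metis length_Suc_conv list.size(4))
  have "length (y # zs) = Suc (length es)" using Cons.prems xs by simp
  from Cons.IH[OF this Cons.prems(2)] show ?case using xs by auto
qed

lemma walk_rev: "walk xs es \<Longrightarrow> walk (rev xs) (rev es)"
proof (induction xs es rule: walk.induct)
  case (2 x y xs e es)
  then show ?case
    using walk_append[of "rev (y # xs)" "rev es" "[x]" e "[]"] walk_length[of "y # xs" es]
    by auto
qed auto

lemma walk_nth: "walk xs es \<Longrightarrow> i < length es \<Longrightarrow> xs ! i \<in> es ! i \<and> xs ! Suc i \<in> es ! i"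
proof (induction xs es arbitrary: i rule: walk.induct)
  case (2 x y xs e es)
  then show ?case by (cases i) auto
qed auto

lemma walk_set_subset: "walk xs es \<Longrightarrow> set xs \<subseteq> insert (hd xs) (\<Union>(set es))"
  by (induction xs es rule: walk.induct) auto

text \<open>\<open>E\<close> is a parameter because hyperedges get deleted later. The vertex set can
  be left out: every vertex after \<open>v\<close> lies in a hyperedge of \<open>es\<close>.\<close>

definition path_from :: "'a set set \<Rightarrow> 'a \<Rightarrow> 'a list \<Rightarrow> 'a set list \<Rightarrow> bool" where
  "path_from E v vs es \<longleftrightarrow>
     walk vs es \<and> hd vs = v \<and> distinct vs \<and> distinct es \<and> set es \<subseteq> E"

lemma path_from_length: "path_from E v vs es \<Longrightarrow> length vs = Suc (length es)"
  by (auto simp: path_from_def walk_length)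

lemma path_from_mono: "path_from E v vs es \<Longrightarrow> E \<subseteq> E' \<Longrightarrow> path_from E' v vs es"
  by (auto simp: path_from_def)

lemma path_from_hd_mem: "path_from E v vs es \<Longrightarrow> v \<in> set vs"
  using path_from_length[of E v vs es] by (cases vs) (auto simp: path_from_def)

lemma path_from_snoc:
  assumes "path_from E v vs es" "f \<in> E" "f \<notin> set es" "last vs \<in> f" "w \<in> f" "w \<notin> set vs"
  shows "path_from E v (vs @ [w]) (es @ [f])"
  using assms walk_append[of vs es "[w]" f "[]"] path_from_length[OF assms(1)]
  by (cases vs) (auto simp: path_from_def)

lemma path_from_prefix:
  assumes "path_from E v (xs @ ys) (es @ e # fs)" "length xs = Suc (length es)"
  shows "path_from E v xs es" "last xs \<in> e"
proof -
  have "ys \<noteq> []" using path_from_length[OF assms(1)] assms(2) by auto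
  then show "path_from E v xs es" "last xs \<in> e"
    using assms walk_append[of xs es ys e fs] by (cases xs; auto simp: path_from_def)+
qed

text \<open>A Posa rotation: \<open>f\<close> replaces \<open>e\<close> as the link to the tail,
  which is traversed backwards. The freed \<open>e\<close> contains the new end vertex, so it can
  take over the role of \<open>f\<close>.\<close>

lemma path_from_rotate:
  assumes p: "path_from E v (xs @ ys) (es @ e # fs)" and l: "length xs = Suc (length es)"
    and f: "f \<in> E" "f \<notin> set (es @ e # fs)" "last xs \<in> f" "last ys \<in> f"
  shows "path_from E v (xs @ rev ys) (es @ f # rev fs)"
    and "last (xs @ rev ys) \<in> e"
proof -
  have ys: "ys \<noteq> []" using path_from_length[OF p] l by auto
  have w: "walk xs es" "hd ys \<in> e" "walk ys fs"
    using p walk_append[OF l ys, of e fs] by (auto simp: path_from_def)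
  have "walk (xs @ rev ys) (es @ f # rev fs)"
    using walk_append[OF l, of "rev ys" f "rev fs"] w ys f walk_rev[OF w(3)]
    by (simp add: hd_rev)
  then show "path_from E v (xs @ rev ys) (es @ f # rev fs)"
    using p f l by (cases xs) (auto simp: path_from_def)
  show "last (xs @ rev ys) \<in> e" using w ys by (simp add: last_rev)
qed

section \<open>From alternating paths to Berge paths and cycles\<close>

lemma path_from_imp_berge_path:
  assumes "path_from E v vs es" "v \<in> V" "E \<subseteq> Pow V"
  shows "berge_path V E (length es) es vs \<and> vs ! 0 = v"
proof -
  have "set vs \<subseteq> V"
    using assms walk_set_subset[of vs es] by (fastforce simp: path_from_def)
  moreover have "vs ! 0 = v"
    using assms path_from_length[OF assms(1)] by (cases vs) (auto simp: path_from_def)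
  ultimately show ?thesis
    using assms walk_nth[of vs es] walk_length[of vs es]
    by (auto simp: path_from_def berge_path_def)
qed

lemma path_from_imp_berge_cycle:
  assumes p: "path_from E v vs es" and "v \<in> V" "E \<subseteq> Pow V"
    and f: "f \<in> E" "f \<notin> set es" "last vs \<in> f" "v \<in> f"
  shows "berge_cycle V E (Suc (length es)) (es @ [f]) vs \<and> v \<in> set vs"
proof -
  have l: "length vs = Suc (length es)" by (rule path_from_length[OF p])
  have w: "walk vs es" using p by (simp add: path_from_def)
  have ne: "vs \<noteq> []" using l by auto
  have v0: "vs ! 0 = v" using p hd_conv_nth[OF ne] by (simp add: path_from_def)
  have last: "vs ! length es = last vs" using last_conv_nth[OF ne] l by simp
  have "set vs \<subseteq> V"
    using assms walk_set_subset[of vs es] by (fastforce simp: path_from_def)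
  moreover have "vs ! i \<in> (es @ [f]) ! i \<and> vs ! (Suc i mod Suc (length es)) \<in> (es @ [f]) ! i"
    if "i < Suc (length es)" for i
  proof (cases "i < length es")
    case True
    then show ?thesis using walk_nth[OF w True] by (simp add: nth_append)
  next
    case False
    with that have "i = length es" by simp
    then show ?thesis using f v0 last by simp
  qed
  ultimately show ?thesis
    using p f l path_from_hd_mem[OF p] by (auto simp: path_from_def berge_cycle_def)
qed

lemma berge_path_or_cycle_if_long_path:
  assumes r: "r \<ge> 2" and E: "E \<subseteq> Pow V" "uniform r E" and v: "v \<in> V"
    and p: "path_from E v vs es" "length es = r"
    and f: "f \<in> E" "f \<notin> set es" "last vs \<in> f"
  shows "(\<exists>es vs. berge_path V E (r + 1) es vs \<and> vs ! 0 = v) \<or>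
         (\<exists>es vs. berge_cycle V E (r + 1) es vs \<and> v \<in> set vs)"
proof (rule ccontr)
  assume no: "\<not> ?thesis"
  \<comment> \<open>A vertex of \<open>g\<close> off the path would give a Berge path, and
    \<open>v\<close> in \<open>g\<close> a Berge cycle. This leaves exactly r candidates for the r
    vertices of \<open>g\<close>.\<close>
  have last_edge: "g = set ws - {v}"
    if q: "path_from E v ws gs" "length gs = r" "g \<in> E" "g \<notin> set gs" "last ws \<in> g" for ws gs g
  proof -
    have "g \<subseteq> set ws"
    proof
      fix w assume "w \<in> g"
      show "w \<in> set ws"
      proof (rule ccontr)
        assume "w \<notin> set ws"
        from path_from_imp_berge_path[OF path_from_snoc[OF q(1,3,4,5) \<open>w \<in> g\<close> this] v E(1)]
        show False using no q(2) by auto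
      qed
    qed
    moreover have "v \<notin> g"
      using path_from_imp_berge_cycle[OF q(1) v E(1) q(3,4,5)] no q(2) by auto
    moreover have "card (set ws - {v}) = r"
      using q path_from_length[OF q(1)] path_from_hd_mem[OF q(1)]
      by (simp add: path_from_def distinct_card)
    moreover have "card g = r" using E q by (simp add: uniform_def)
    ultimately show ?thesis by (intro card_subset_eq) auto
  qed
  have f_eq: "f = set vs - {v}" by (rule last_edge[OF p f])
  \<comment> \<open>The rotation is made at the second hyperedge \<open>b\<close>: it needs
    \<open>f\<close> to contain the vertex before \<open>b\<close>, and \<open>f\<close> misses only
    \<open>v\<close>.\<close>
  obtain a b es' where es: "es = a # b # es'"
    using p(2) r by (cases es; cases "tl es") auto
  obtain x ys where "vs = v # x # ys"
    using p es path_from_length[OF p(1)]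
    by (cases vs; cases "tl vs") (auto simp: path_from_def)
  then have vs: "vs = [v, x] @ ys" by simp
  have ys: "ys \<noteq> []" using path_from_length[OF p(1)] vs es by auto
  have x: "x \<noteq> v" using p vs by (auto simp: path_from_def)
  have p': "path_from E v ([v, x] @ ys) ([a] @ b # es')" using p vs es by simp
  have "last [v, x] \<in> f" "last ys \<in> f" using f_eq f(3) x vs ys by auto
  note rot = path_from_rotate[OF p' _ f(1) _ this]
  have "b = set ([v, x] @ rev ys) - {v}"
    by (rule last_edge[OF rot(1) _ _ _ rot(2)]) (use f es p in \<open>auto simp: path_from_def\<close>)
  then have "b = f" using f_eq vs by simp
  then show False using f(2) es by simp
qed

section \<open>Depth-first search\<close>

text \<open>Connectedness through closed sets instead of sequences; this form passes easily to the
  hypergraph left after a deletion.\<close>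

definition reaches_all :: "'a set \<Rightarrow> 'a set set \<Rightarrow> 'a \<Rightarrow> bool" where
  "reaches_all V E v \<longleftrightarrow> (\<forall>A. v \<in> A \<longrightarrow> (\<forall>e\<in>E. e \<inter> A \<noteq> {} \<longrightarrow> e \<subseteq> A) \<longrightarrow> V \<subseteq> A)"

lemma connected_hypergraph_reaches_all:
  assumes "connected_hypergraph V E" "v \<in> V"
  shows "reaches_all V E v"
  unfolding reaches_all_def
proof (intro allI impI subsetI)
  fix A x
  assume A: "v \<in> A" "\<forall>e\<in>E. e \<inter> A \<noteq> {} \<longrightarrow> e \<subseteq> A" and "x \<in> V"
  then obtain m :: nat and p where p: "p 0 = v" "p m = x"
    "\<forall>j<m. \<exists>e\<in>E. p j \<in> e \<and> p (Suc j) \<in> e"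
    using assms unfolding connected_hypergraph_def by meson
  have "j \<le> m \<Longrightarrow> p j \<in> A" for j
  proof (induction j)
    case 0
    then show ?case using A p by simp
  next
    case (Suc j)
    then obtain e where "e \<in> E" "p j \<in> e" "p (Suc j) \<in> e" using p(3) Suc_le_lessD by blast
    with Suc A show ?case by auto
  qed
  then show "x \<in> A" using p by auto
qed

text \<open>
  \<open>A\<close> and \<open>B\<close> are the visited vertices and hyperedges of a depth-first search with stack
  \<open>vs\<close>, \<open>es\<close>; each newly visited hyperedge comes together with a newly visited vertex.
\<close>

lemma dfs_card_less:
  assumes fin: "finite V" and E: "E \<subseteq> Pow V" "{} \<notin> E" and conn: "reaches_all V E v"
    and ext: "\<And>vs es f. path_from E v vs es \<Longrightarrow> f \<in> E \<Longrightarrow> f \<notin> set es \<Longrightarrow> last vs \<in> f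
                \<Longrightarrow> \<not> f \<subseteq> set vs"
    and "path_from E v vs es" "set vs \<subseteq> A" "A \<subseteq> V" "set es \<subseteq> B" "B \<subseteq> E" "card B < card A"
    and "\<And>a e. a \<in> A - set vs \<Longrightarrow> e \<in> E \<Longrightarrow> a \<in> e \<Longrightarrow> e \<in> B"
    and "\<And>b. b \<in> B - set es \<Longrightarrow> b \<subseteq> A"
  shows "card E < card V"
  using assms(6-)
\<comment> \<open>The measure drops whenever a vertex is visited. Popping the stack visits nothing
  and is handled by an inner induction on \<open>es\<close>.\<close>
proof (induction "card V - card A" arbitrary: A B vs es rule: less_induct)
  case less
  have AB: "A \<subseteq> V" "B \<subseteq> E" "card B < card A" by (rule less.prems)+
  have finA: "finite A" by (rule finite_subset[OF AB(1) fin])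
  have "finite E" using fin E(1) by (simp add: finite_subset)
  then have finB: "finite B" by (rule finite_subset[OF AB(2)])
  have smaller: "card V - card (insert w A) < card V - card A" if "w \<in> V" "w \<notin> A" for w
  proof -
    have "card (insert w A) \<le> card V" by (rule card_mono) (use that fin AB in auto)
    then show ?thesis using that finA by simp
  qed
  have push: "card E < card V"
    if p: "path_from E v vs es" and AB': "set vs \<subseteq> A" "set es \<subseteq> B"
      and cl: "\<And>a e. a \<in> A - set vs \<Longrightarrow> e \<in> E \<Longrightarrow> a \<in> e \<Longrightarrow> e \<in> B"
        "\<And>b. b \<in> B - set es \<Longrightarrow> b \<subseteq> A"
      and f: "f \<in> E" "f \<notin> B" "last vs \<in> f" for vs es f
  proof -
    have fs: "f \<notin> set es" using f AB' by auto
    obtain w where w: "w \<in> f" "w \<notin> set vs" using ext[OF p f(1) fs f(3)] by auto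
    \<comment> \<open>A visited vertex off the stack has only visited hyperedges, whereas
      \<open>f\<close> is unvisited.\<close>
    have wA: "w \<notin> A" using cl(1)[of w f] w f by auto
    have wV: "w \<in> V" using E f w by auto
    show ?thesis
    proof (rule less.hyps[OF smaller[OF wV wA] path_from_snoc[OF p f(1) fs f(3) w]])
      show "set (vs @ [w]) \<subseteq> insert w A" "set (es @ [f]) \<subseteq> insert f B"
        "insert w A \<subseteq> V" "insert f B \<subseteq> E"
        using AB AB' wV f by auto
      show "card (insert f B) < card (insert w A)" using AB finA finB f wA by simp
      show "e \<in> insert f B" if "a \<in> insert w A - set (vs @ [w])" "e \<in> E" "a \<in> e" for a e
        using cl(1)[of a e] that by auto
      show "b \<subseteq> insert w A" if "b \<in> insert f B - set (es @ [f])" for b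
        using cl(2)[of b] that by auto
    qed
  qed
  from less.prems(1,2,4,7,8) show ?case
  proof (induction es arbitrary: vs rule: rev_induct)
    case Nil
    note N = Nil
    have lv: "vs = [v]"
      using path_from_length[OF N(1)] N(1) by (cases vs) (auto simp: path_from_def)
    show ?case
    proof (cases "\<exists>f\<in>E - B. last vs \<in> f")
      case True
      then show ?thesis using push[OF N] by auto
    next
      case False
      \<comment> \<open>Only the root is left on the stack and its hyperedges are all visited, so
        \<open>A\<close> is closed and the search has exhausted \<open>V\<close> and
        \<open>E\<close>.\<close>
      have cl: "e \<in> B" if "e \<in> E" "e \<inter> A \<noteq> {}" for e
      proof -
        obtain a where "a \<in> e" "a \<in> A" using \<open>e \<inter> A \<noteq> {}\<close> by auto
        then show ?thesis using that(1) False N(4)[of a e] lv by (cases "a = v") auto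
      qed
      have "v \<in> A" using N(2) lv by simp
      moreover have "e \<subseteq> A" if "e \<in> E" "e \<inter> A \<noteq> {}" for e
        using N(5)[of e] cl[OF that] by simp
      ultimately have "V \<subseteq> A"
        using conn[unfolded reaches_all_def, THEN spec, of A] by simp
      with AB have "A = V" by simp
      have "E \<subseteq> B"
      proof
        fix e assume e: "e \<in> E"
        then have "e \<noteq> {}" "e \<subseteq> A" using E \<open>A = V\<close> by auto
        then show "e \<in> B" using cl[OF e] by auto
      qed
      then show ?thesis using AB \<open>A = V\<close> by simp
    qed
  next
    case (snoc e es)
    note N = snoc.prems
    show ?case
    proof (cases "\<exists>f\<in>E - B. last vs \<in> f")
      case True
      then show ?thesis using push[OF N] by auto
    next
      case False
      obtain us u where vs: "vs = us @ [u]" and us: "length us = Suc (length es)"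
        using path_from_length[OF N(1)] by (cases vs rule: rev_cases) auto
      have "path_from E v (us @ [u]) (es @ e # [])" using N(1) vs by simp
      note pre = path_from_prefix[OF this us]
      have eE: "e \<in> E" "e \<notin> set es" using N(1) by (auto simp: path_from_def)
      have sub: "set us \<subseteq> A" "set es \<subseteq> B" "e \<in> B" using N(2,3) vs by auto
      \<comment> \<open>The top vertex \<open>u\<close> is finished and popped. Next,
        \<open>e\<close> is popped too if all its vertices are visited; otherwise it leads to a new
        vertex, and \<open>B\<close> does not grow.\<close>
      have cl: "e' \<in> B" if "a \<in> A - set us" "e' \<in> E" "a \<in> e'" for a e'
        using that False N(4)[of a e'] vs by (cases "a = u") auto
      show ?thesis
      proof (cases "e \<subseteq> A")
        case True
        have "b \<subseteq> A" if "b \<in> B - set es" for b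
          using N(5)[of b] that True by (cases "b = e") auto
        from snoc.IH[OF pre(1) sub(1,2) cl this] show ?thesis by simp
      next
        case False
        then obtain w where w: "w \<in> e" "w \<notin> A" by auto
        have wV: "w \<in> V" using E w eE by auto
        have ws: "w \<notin> set us" using w sub by auto
        show ?thesis
        proof (rule less.hyps[OF smaller[OF wV w(2)] path_from_snoc[OF pre(1) eE pre(2) w(1) ws]])
          show "set (us @ [w]) \<subseteq> insert w A" "set (es @ [e]) \<subseteq> B"
            "insert w A \<subseteq> V" "B \<subseteq> E" "card B < card (insert w A)"
            using AB sub wV w finA by auto
          show "e' \<in> B" if "a \<in> insert w A - set (us @ [w])" "e' \<in> E" "a \<in> e'" for a e'
            using cl[of a e'] that by auto
          show "b \<subseteq> insert w A" if "b \<in> B - set (es @ [e])" for b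
            using N(5)[of b] that by auto
        qed
      qed
    qed
  qed
qed

section \<open>Removing a short cycle\<close>

lemma card_less_if_no_long_path:
  assumes "r \<ge> 2" "finite V" "E \<subseteq> Pow V" "uniform r E" "reaches_all V E v" "v \<in> V"
    and "\<And>vs es f. path_from E v vs es \<Longrightarrow> length es = r \<Longrightarrow> f \<in> E \<Longrightarrow> last vs \<in> f \<Longrightarrow> f \<in> set es"
  shows "card E < card V"
  using assms(2-)
proof (induction "card V" arbitrary: V E rule: less_induct)
  case less
  note r = assms(1) and fin = less.prems(1) and E = less.prems(2) and un = less.prems(3)
    and conn = less.prems(4) and v = less.prems(5) and short = less.prems(6)
  have cE: "card e = r" if "e \<in> E" for e using un that by (simp add: uniform_def)
  have finE: "finite E" using fin E finite_subset by blast
  show ?case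
  proof (cases "\<exists>vs es f. path_from E v vs es \<and> length es = r - 1 \<and> f \<in> E \<and> f \<notin> set es \<and> f \<subseteq> set vs")
    case False
    \<comment> \<open>Containing \<open>f\<close> takes at least r vertices. More than r hyperedges
      contradict \<open>short\<close> on a prefix, exactly r contradict it with \<open>f\<close>
      itself, and r - 1 is excluded by the case assumption.\<close>
    have ext: "\<not> f \<subseteq> set vs"
      if p: "path_from E v vs es" and f: "f \<in> E" "f \<notin> set es" "last vs \<in> f" for vs es f
    proof
      assume sub: "f \<subseteq> set vs"
      have "r \<le> length vs"
        using card_mono[OF _ sub] cE[OF f(1)] card_length[of vs] by simp
      then have ge: "length es \<ge> r - 1" using path_from_length[OF p] by simp
      have "length es \<le> r"
      proof (rule ccontr)
        assume "\<not> length es \<le> r"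
        then have es: "es = take r es @ es ! r # drop (Suc r) es"
          by (simp add: id_take_nth_drop)
        have l: "length (take (Suc r) vs) = Suc (length (take r es))"
          using path_from_length[OF p] \<open>\<not> length es \<le> r\<close> by simp
        have p': "path_from E v (take (Suc r) vs @ drop (Suc r) vs) (take r es @ es ! r # drop (Suc r) es)"
          using p es by simp
        have "es ! r \<in> E" using p \<open>\<not> length es \<le> r\<close> by (auto simp: path_from_def)
        from short[OF path_from_prefix(1)[OF p' l] _ this path_from_prefix(2)[OF p' l]]
        have "es ! r \<in> set (take r es)" using \<open>\<not> length es \<le> r\<close> by simp
        moreover have "distinct (take r es @ es ! r # drop (Suc r) es)"
          using p es by (simp add: path_from_def)
        ultimately show False by simp
      qed
      moreover have "length es \<noteq> r" using short[OF p _ f(1,3)] f(2) by auto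
      ultimately have "length es = r - 1" using ge by simp
      then show False using False p f sub by blast
    qed
    have ne: "{} \<notin> E" using cE[of "{}"] r by auto
    have start: "path_from E v [v] []" by (simp add: path_from_def)
    show ?thesis
      by (rule dfs_card_less[OF fin E ne conn ext start, where A = "{v}" and B = "{}"])
        (simp_all add: v)
  next
    case True
    then obtain vs es f where p: "path_from E v vs es" and les: "length es = r - 1"
      and f: "f \<in> E" "f \<notin> set es" "f \<subseteq> set vs" by blast
    have lvs: "length vs = r" using path_from_length[OF p] les r by simp
    have dvs: "distinct vs" "distinct es" "set es \<subseteq> E" using p by (auto simp: path_from_def)
    have f_eq: "f = set vs"
      using f(3) cE[OF f(1)] lvs dvs by (intro card_subset_eq) (auto simp: distinct_card)
    have vvs: "v \<in> set vs" by (rule path_from_hd_mem[OF p])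
    have subV: "set vs \<subseteq> V" using f_eq f E by auto

    \<comment> \<open>Rotating with \<open>f\<close> in place of \<open>e\<close> makes
      \<open>hd ys\<close> the end, and \<open>h\<close> then leads out of the cycle to
      \<open>w\<close>. This path has r hyperedges, so \<open>short\<close> forces every hyperedge
      at \<open>w\<close> to be on it. The choice \<open>h = e\<close> is allowed.\<close>
    have tail_closed: "g \<in> insert h (insert f (set es))"
      if s: "vs = xs @ ys" "es = es1 @ e # es2" "length xs = Suc (length es1)"
        and h: "h \<in> E" "h \<notin> insert f (set es1 \<union> set es2)" "hd ys \<in> h" "w \<in> h" "w \<notin> set vs"
        and g: "g \<in> E" "w \<in> g"
      for xs ys es1 e es2 h w g
    proof -
      have ys: "ys \<noteq> []" "xs \<noteq> []" using path_from_length[OF p] s by auto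
      have q: "path_from E v (xs @ rev ys) (es1 @ f # rev es2)"
        using path_from_rotate(1)[of E v xs ys es1 e es2 f] p s f f_eq ys by auto
      have "path_from E v ((xs @ rev ys) @ [w]) ((es1 @ f # rev es2) @ [h])"
        by (rule path_from_snoc[OF q]) (use h s ys in \<open>auto simp: last_rev\<close>)
      from short[OF this _ g(1)] show ?thesis using g s les r by auto
    qed

    text \<open>\<open>S\<close> consists of the vertices to be deleted and \<open>D\<close> of the hyperedges meeting \<open>S\<close>.
      Each hyperedge in \<open>F\<close> pays for itself with a vertex of degree one in \<open>W\<close>; the \<open>r\<close> hyperedges
      of the cycle are paid for by its vertices other than \<open>v\<close> and a vertex in \<open>U\<close>.\<close>
    define U where "U = \<Union>(set es) - set vs"
    define F where "F = {g \<in> E. g \<notin> insert f (set es) \<and> g \<inter> (set vs - {v}) \<noteq> {}}"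
    define W where "W = \<Union>F - set vs"
    define S where "S = (set vs - {v}) \<union> U \<union> W"
    define D where "D = insert f (set es \<union> F)"

    \<comment> \<open>Here \<open>h\<close> is the cycle hyperedge \<open>e\<close> through
      \<open>u\<close>, which the rotation at \<open>e\<close> sets free.\<close>
    have U_edges: "g \<in> set es" if "u \<in> U" "g \<in> E" "u \<in> g" for u g
    proof -
      obtain e where e: "e \<in> set es" "u \<in> e" "u \<notin> set vs"
        using \<open>u \<in> U\<close> by (auto simp: U_def)
      obtain es1 es2 where s: "es = es1 @ e # es2" using e split_list by metis
      define xs ys where "xs = take (Suc (length es1)) vs" and "ys = drop (Suc (length es1)) vs"
      have xy: "vs = xs @ ys" by (simp add: xs_def ys_def)
      have l: "length xs = Suc (length es1)" using path_from_length[OF p] s by (simp add: xs_def)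
      have ys: "ys \<noteq> []" using path_from_length[OF p] s xy l by auto
      have "hd ys \<in> e"
        using p walk_append[OF l ys, of e es2] xy s by (auto simp: path_from_def)
      from tail_closed[OF xy s l _ _ this e(2,3) that(2,3)]
      have "g \<in> insert e (insert f (set es))" using e dvs s f by auto
      moreover have "g \<noteq> f" using f_eq that e by auto
      ultimately show ?thesis using e by auto
    qed

    \<comment> \<open>Splitting just before \<open>x\<close> makes \<open>x\<close> the end after
      rotation, so \<open>h\<close> can be appended. A \<open>g\<close> in \<open>es\<close> would
      put \<open>w\<close> into \<open>U\<close>, and then \<open>h\<close> would be in
      \<open>es\<close> as well.\<close>
    have W_edges: "g = h" if "h \<in> F" "w \<in> h" "w \<notin> set vs" "g \<in> E" "w \<in> g" for h w g
    proof -
      obtain x where x: "x \<in> h" "x \<in> set vs" "x \<noteq> v" and h: "h \<in> E" "h \<notin> insert f (set es)"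
        using \<open>h \<in> F\<close> by (auto simp: F_def)
      obtain xs zs where xy: "vs = xs @ x # zs" using x split_list by metis
      have "xs \<noteq> []" using xy x p by (auto simp: path_from_def)
      then obtain k where k: "length xs = Suc k" by (cases xs) auto
      have "k < length es" using path_from_length[OF p] xy k by simp
      then have s: "es = take k es @ es ! k # drop (Suc k) es" by (simp add: id_take_nth_drop)
      have "length xs = Suc (length (take k es))" using k \<open>k < length es\<close> by simp
      moreover have "h \<notin> insert f (set (take k es) \<union> set (drop (Suc k) es))"
        using h by (auto dest: in_set_takeD in_set_dropD)
      ultimately have "g \<in> insert h (insert f (set es))"
        using tail_closed[OF xy s _ h(1) _ _ that(2,3,4,5)] x by simp
      moreover have "g \<noteq> f" using that f_eq by auto
      moreover have "g \<notin> set es"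
        using U_edges[of w h] that h by (auto simp: U_def)
      ultimately show ?thesis by auto
    qed

    \<comment> \<open>By uniformity only \<open>f\<close> fits inside the cycle's vertex set; this
      yields a vertex in \<open>U\<close> and a private vertex for each hyperedge in
      \<open>F\<close>.\<close>
    have not_sub: "\<not> g \<subseteq> set vs" if "g \<in> E" "g \<noteq> f" for g
    proof
      assume "g \<subseteq> set vs"
      then have "g = f"
        using f_eq cE[OF that(1)] cE[OF f(1)] by (intro card_subset_eq) auto
      with that show False by simp
    qed
    have UW: "U \<inter> W = {}"
      using U_edges by (fastforce simp: W_def F_def)
    have SV: "S \<subseteq> V" using subV E dvs by (auto simp: S_def U_def W_def F_def)
    have finS: "finite S" using SV fin finite_subset by blast
    have "hd es \<in> set es" using les r by (cases es) auto
    then have "U \<noteq> {}" using not_sub[of "hd es"] dvs f by (auto simp: U_def)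
    then have cU: "card U \<ge> 1" using finS by (simp add: S_def Suc_leI card_gt_0_iff)
    have cW: "card F \<le> card W"
    proof -
      have "\<forall>g\<in>F. \<exists>w. w \<in> g - set vs" using not_sub by (fastforce simp: F_def)
      then obtain c where c: "\<And>g. g \<in> F \<Longrightarrow> c g \<in> g - set vs" by metis
      have "inj_on c F"
      proof (rule inj_onI)
        fix g h assume gh: "g \<in> F" "h \<in> F" "c g = c h"
        show "g = h" by (rule W_edges[of h "c h"]) (use gh c[of g] c[of h] in \<open>auto simp: F_def\<close>)
      qed
      moreover have "c ` F \<subseteq> W" using c by (auto simp: W_def)
      moreover have "finite W" using finS by (simp add: S_def)
      ultimately show ?thesis by (rule card_inj_on_le)
    qed
    have "card S = (r - 1) + card U + card W"
    proof -
      have "card S = card ((set vs - {v}) \<union> U) + card W"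
        unfolding S_def by (rule card_Un_disjoint) (use finS UW in \<open>auto simp: S_def W_def\<close>)
      also have "card ((set vs - {v}) \<union> U) = card (set vs - {v}) + card U"
        by (rule card_Un_disjoint) (use finS in \<open>auto simp: S_def U_def\<close>)
      also have "card (set vs - {v}) = r - 1"
        using vvs lvs dvs by (simp add: distinct_card)
      finally show ?thesis .
    qed
    moreover have "card D \<le> Suc (r - 1 + card F)"
    proof -
      have "card D \<le> Suc (card (set es \<union> F))"
        unfolding D_def by (rule card_insert_le_m1[THEN order_trans, OF _ _ order_refl]) auto
      also have "card (set es \<union> F) \<le> r - 1 + card F"
        using card_Un_le[of "set es" F] les dvs by (simp add: distinct_card)
      finally show ?thesis by simp
    qed
    ultimately have cDS: "card D \<le> card S" using cU cW by simp

    \<comment> \<open>This and \<open>D_if\<close> say that \<open>S\<close> is attached to the rest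
      only at \<open>v\<close>.\<close>
    have D_sub: "e \<subseteq> insert v S" if "e \<in> D" for e
      using that f_eq by (auto simp: D_def S_def U_def W_def)
    have D_if: "e \<in> D" if "e \<in> E" "e \<inter> S \<noteq> {}" for e
    proof (rule ccontr)
      assume "e \<notin> D"
      then have e: "e \<notin> insert f (set es)" "e \<notin> F" by (auto simp: D_def)
      have "e \<inter> (set vs - {v}) = {}" using e \<open>e \<in> E\<close> by (simp add: F_def)
      moreover have "e \<inter> U = {}" using U_edges[OF _ \<open>e \<in> E\<close>] e by auto
      moreover have "e \<inter> W = {}" using W_edges[OF _ _ _ \<open>e \<in> E\<close>] e by (auto simp: W_def)
      ultimately show False using \<open>e \<inter> S \<noteq> {}\<close> by (auto simp: S_def)
    qed
    have DE: "D \<subseteq> E" using f dvs by (auto simp: D_def F_def)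
    have vS: "v \<notin> S" using vvs by (auto simp: S_def U_def W_def)

    have "card (E - D) < card (V - S)"
    proof (rule less.hyps)
      have "S \<noteq> {}" using \<open>U \<noteq> {}\<close> by (auto simp: S_def)
      then show "card (V - S) < card V" using SV fin by (intro psubset_card_mono) auto
      show "finite (V - S)" using fin by simp
      show "E - D \<subseteq> Pow (V - S)" using E D_if by blast
      show "uniform r (E - D)" using un by (simp add: uniform_def)
      show "v \<in> V - S" using v vS by simp
      show "reaches_all (V - S) (E - D) v"
        unfolding reaches_all_def
      proof (intro allI impI)
        fix A assume A: "v \<in> A" "\<forall>e\<in>E - D. e \<inter> A \<noteq> {} \<longrightarrow> e \<subseteq> A"
        \<comment> \<open>A closed set of the smaller hypergraph becomes closed in the larger one
          after adding \<open>S\<close>: hyperedges in \<open>D\<close> stay within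
          \<open>insert v S\<close>, and all others avoid \<open>S\<close>.\<close>
        have "e \<subseteq> A \<union> S" if "e \<in> E" "e \<inter> (A \<union> S) \<noteq> {}" for e
        proof (cases "e \<in> D")
          case True
          then show ?thesis using D_sub A by auto
        next
          case False
          with D_if that A show ?thesis by blast
        qed
        then have "V \<subseteq> A \<union> S"
          using conn[unfolded reaches_all_def, THEN spec, of "A \<union> S"] A(1) by simp
        then show "V - S \<subseteq> A" by auto
      qed
      show "g \<in> set gs" if "path_from (E - D) v ws gs" "length gs = r" "g \<in> E - D" "last ws \<in> g"
        for ws gs g
        using short[OF path_from_mono[OF that(1)]] that by auto
    qed
    moreover have "card (E - D) = card E - card D" "card (V - S) = card V - card S"
      using card_Diff_subset[OF finite_subset[OF DE finE] DE]
        card_Diff_subset[OF finS SV] by simp_all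
    ultimately show ?thesis using cDS by simp
  qed
qed

theorem theorem3:
  fixes r n :: nat and V :: "'a set" and E :: "'a set set"
  assumes "r \<ge> 2"
    and "hypergraph V E"
    and "uniform r E"
    and "connected_hypergraph V E"
    and "card V = n"
    and "card E \<ge> n"
  shows "\<forall>v\<in>V. (\<exists>es vs. berge_path V E (r + 1) es vs \<and> vs ! 0 = v) \<or>
                (\<exists>es vs. berge_cycle V E (r + 1) es vs \<and> v \<in> set vs)"
proof
  fix v assume v: "v \<in> V"
  have E: "finite V" "E \<subseteq> Pow V" using assms(2) by (auto simp: hypergraph_def)
  have "\<exists>vs es f. path_from E v vs es \<and> length es = r \<and> f \<in> E \<and> last vs \<in> f \<and> f \<notin> set es"
  proof (rule ccontr)
    assume "\<not> ?thesis"
    then have "card E < card V"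
      using card_less_if_no_long_path[OF assms(1) E assms(3)
          connected_hypergraph_reaches_all[OF assms(4) v] v] by blast
    then show False using assms by simp
  qed
  then show "(\<exists>es vs. berge_path V E (r + 1) es vs \<and> vs ! 0 = v) \<or>
             (\<exists>es vs. berge_cycle V E (r + 1) es vs \<and> v \<in> set vs)"
    using berge_path_or_cycle_if_long_path[OF assms(1) E(2) assms(3) v] by blast
qed

end
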